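(* For a prime $p$, let $I(p)$ denote the number of solutions of the congruence $$x^x\equiv y^y\pmod p,\qquad x\in\mathbb{N},\quad y\in\mathbb{N},\quad x\le p-1,\quad y\le p-1.$$ Then, as $p\to\infty$, $I(p)\lesssim p^{23/12}$; that is, for every $\varepsilon>0$ there exists a constant $c=c(\varepsilon)>0$ such that for every prime $p$ one has $I(p)<c\,p^{23/12+\varepsilon}$.
   Context: $\mathbb{N}$ denotes the set of positive integers. The notation $A\lesssim B$ means $A<Bp^{o(1)}$; that is, for any $\varepsilon>0$ there exists $c=c(\varepsilon)>0$ such that $A<cBp^{\varepsilon}$. *)

theory Defs
  imports Complex_Main "HOL-Number_Theory.Cong"
begin

definition solutions :: "nat \<Rightarrow> (nat \<times> nat) set" where
  "solutions p = {(x, y). x \<in> {1..p - 1} \<and> y \<in> {1..p - 1} \<and> [x ^ x = y ^ y] (mod p)}"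

definition I :: "nat \<Rightarrow> nat" where
  "I p = card (solutions p)"

end

theory Submission
  imports Defs "HOL-Number_Theory.Number_Theory" "HOL-Analysis.Kronecker_Approximation_Theorem"
begin

text \<open>
  We show \<open>I(p) \<le> 4 p\<^bsup>15/8\<^esup> \<tau>(p - 1)\<^sup>2\<close> for odd \<open>p\<close>, which suffices by the divisor bound and since
  \<open>15/8 < 23/12\<close>. It is enough to bound, for each \<open>l\<close> and each factorization \<open>p - 1 = d n\<close>, the
  number \<open>J\<close> of \<open>u \<le> n\<close> coprime to \<open>n\<close> such that \<open>x = d u\<close> solves \<open>x\<^sup>x \<equiv> l\<close>. Raising to the inverse
  \<open>u'\<close> of \<open>u\<close> modulo \<open>n\<close> gives \<open>(d u)\<^sup>d \<equiv> l\<^bsup>u'\<^esup>\<close>. So if two solutions \<open>u\<close>, \<open>v\<close> satisfy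
  \<open>v' - u' \<equiv> h\<close> modulo \<open>n\<close>, then \<open>v \<equiv> c u\<close> modulo \<open>p\<close> for one of the at most \<open>d\<close> roots of
  \<open>c\<^sup>d \<equiv> l\<^sup>h\<close>, and \<open>u - v \<equiv> h u v\<close> modulo \<open>n\<close>. Hence \<open>J\<^sup>2\<close> is at most the sum over \<open>h\<close> and \<open>c\<close> of the
  number \<open>M\<close> of such pairs \<open>(u, v)\<close>.

  To bound \<open>M\<close>, write \<open>c \<equiv> a/b\<close> modulo \<open>p\<close> with coprime \<open>a\<close>, \<open>b\<close> of absolute value at most
  \<open>A \<le> 2 \<surd>p\<close>. The form \<open>b v - a u\<close> is divisible by \<open>p\<close>, so it takes \<open>O(A)\<close> values, and pairs with the
  same value differ by \<open>m (b, a)\<close> with \<open>\<bar>m\<bar> \<le> n / A\<close>. If \<open>(u, v)\<close> and its translate by \<open>m (b, a)\<close> are both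
  solutions, then \<open>h m (a u + b v)\<close> is determined modulo \<open>n\<close>, which leaves \<open>O(A gcd(h m, n))\<close> values
  of \<open>a u + b v\<close>, and each of them determines \<open>(u, v)\<close>. Summing over \<open>m\<close> and applying the
  Cauchy--Schwarz inequality yields \<open>M\<^sup>2 \<le> 55 A n gcd(h, n) \<tau>(n)\<close>.
\<close>

section \<open>Divisor sums and counting\<close>

definition divisor_count :: "nat \<Rightarrow> nat" where
  "divisor_count n = card {d. d dvd n}"

lemma divisor_count_pos: "n > 0 \<Longrightarrow> divisor_count n \<ge> 1"
  using card_gt_0_iff[of "{d. d dvd n}"] by (force simp: divisor_count_def Suc_le_eq)

lemma divisor_count_mono:
  assumes "m dvd n" "n > 0"
  shows "divisor_count m \<le> divisor_count n"
  unfolding divisor_count_def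
proof (rule card_mono)
  show "finite {d. d dvd n}" using assms by simp
  show "{d. d dvd m} \<subseteq> {d. d dvd n}" using dvd_trans[OF _ assms(1)] by blast
qed

text \<open>A divisor of \<open>n\<close> is determined by its multiplicities at the primes of
  \<open>n\<close>, and each of these is at most the multiplicity in \<open>n\<close>.\<close>

lemma divisor_count_le_prod_multiplicity:
  assumes "n > 0"
  shows "divisor_count n \<le> (\<Prod>q\<in>prime_factors n. Suc (multiplicity q n))"
proof -
  let ?P = "prime_factors n"
  let ?f = "\<lambda>d. restrict (\<lambda>q. multiplicity q d) ?P"
  have "inj_on ?f {d. d dvd n}"
  proof (rule inj_onI)
    fix x y assume xy: "x \<in> {d. d dvd n}" "y \<in> {d. d dvd n}" "?f x = ?f y"
    have "multiplicity q x = multiplicity q y" if "prime q" for q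
    proof (cases "q \<in> ?P")
      case True
      then show ?thesis using fun_cong[OF xy(3), of q] by simp
    next
      case False
      then have "\<not> q dvd n" using that assms by (auto simp: in_prime_factors_iff)
      then have "\<not> q dvd x" "\<not> q dvd y" using xy dvd_trans by auto
      then show ?thesis by (simp add: not_dvd_imp_multiplicity_0)
    qed
    moreover have "x > 0" "y > 0"
      using xy(1,2) assms by (simp_all add: dvd_pos_nat)
    ultimately show "x = y" by (rule multiplicity_eq_nat[rotated 2])
  qed
  moreover have "?f ` {d. d dvd n} \<subseteq> (\<Pi>\<^sub>E q\<in>?P. {..multiplicity q n})"
    using assms by (auto intro!: dvd_imp_multiplicity_le)
  moreover have "finite (\<Pi>\<^sub>E q\<in>?P. {..multiplicity q n})" by (intro finite_PiE) auto
  ultimately have "card {d. d dvd n} \<le> card (\<Pi>\<^sub>E q\<in>?P. {..multiplicity q n})"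
    by (intro card_inj_on_le)
  then show ?thesis by (simp add: card_PiE divisor_count_def)
qed

text \<open>Compare \<open>a + 1\<close> with \<open>q ^ (a \<delta>)\<close> for each prime power
  \<open>q ^ a\<close> exactly dividing \<open>n\<close>. Only primes below \<open>B\<close> can
  lose a factor, each at most \<open>K\<close>, so \<open>C = K ^ B\<close> works for all
  \<open>n\<close>.\<close>

lemma divisor_count_bound:
  fixes \<delta> :: real
  assumes "\<delta> > 0"
  obtains C where "C \<ge> 1" "\<And>n. n > 0 \<Longrightarrow> real (divisor_count n) \<le> C * real n powr \<delta>"
proof -
  \<comment> \<open>For \<open>q \<ge> B\<close> one has \<open>q powr \<delta> \<ge> 2\<close>, and
    \<open>2 ^ a \<ge> a + 1\<close>. For smaller \<open>q\<close>, \<open>K\<close> is chosen so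
    that \<open>a + 1 \<le> K (1 + a \<delta> ln 2) \<le> K * 2 powr (a \<delta>)\<close>.\<close>
  define B where "B = nat \<lceil>2 powr (1 / \<delta>)\<rceil>"
  define K where "K = max 1 (1 / (\<delta> * ln 2))"
  have K: "K \<ge> 1" "K * (\<delta> * ln 2) \<ge> 1"
  proof -
    have pos: "\<delta> * ln 2 > 0" using assms by simp
    show "K \<ge> 1" by (simp add: K_def)
    have "1 / (\<delta> * ln 2) * (\<delta> * ln 2) \<le> K * (\<delta> * ln 2)"
      using pos by (intro mult_right_mono) (auto simp: K_def)
    then show "K * (\<delta> * ln 2) \<ge> 1" using assms by simp
  qed
  have local_bound: "real (Suc a) \<le> (if q < B then K else 1) * real (q ^ a) powr \<delta>"
    if q: "prime q" for q a
  proof (cases "q < B")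
    case True
    have q2: "q \<ge> 2" using q prime_ge_2_nat by blast
    have "real (Suc a) \<le> K * (1 + real a * (\<delta> * ln 2))"
    proof -
      have "real a * 1 \<le> real a * (K * (\<delta> * ln 2))" using K by (intro mult_left_mono) auto
      then show ?thesis using K by (simp add: algebra_simps)
    qed
    also have "\<dots> \<le> K * exp (real a * (\<delta> * ln 2))"
      using K exp_ge_add_one_self by (intro mult_left_mono) auto
    also have "exp (real a * (\<delta> * ln 2)) = real (2 ^ a) powr \<delta>"
      by (simp add: powr_def ln_realpow algebra_simps)
    also have "K * real (2 ^ a) powr \<delta> \<le> K * real (q ^ a) powr \<delta>"
      using K q2 assms by (intro mult_left_mono powr_mono2) (auto intro!: power_mono)
    finally show ?thesis using True by simp
  next
    case False
    have "real (Suc a) \<le> 2 ^ a"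
      using less_exp[of a] by (metis Suc_leI of_nat_le_iff of_nat_numeral of_nat_power)
    also have "\<dots> = ((2 powr (1 / \<delta>)) ^ a) powr \<delta>"
    proof -
      have "((2::real) powr (1 / \<delta>)) ^ a = 2 powr (real a / \<delta>)"
        by (simp add: powr_power)
      then show ?thesis using assms by (simp add: powr_powr powr_realpow)
    qed
    also have "\<dots> \<le> real (q ^ a) powr \<delta>"
    proof -
      have "2 powr (1 / \<delta>) \<le> real q" using False unfolding B_def by linarith
      then show ?thesis using assms by (intro powr_mono2) (auto intro!: power_mono)
    qed
    finally show ?thesis using False by simp
  qed
  have "real (divisor_count n) \<le> K ^ B * real n powr \<delta>" if n: "n > 0" for n
  proof -
    let ?P = "prime_factors n"
    have "real (divisor_count n) \<le> real (\<Prod>q\<in>?P. Suc (multiplicity q n))"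
      using divisor_count_le_prod_multiplicity[OF n] of_nat_le_iff by blast
    also have "\<dots> = (\<Prod>q\<in>?P. real (Suc (multiplicity q n)))" by simp
    also have "\<dots> \<le> (\<Prod>q\<in>?P. (if q < B then K else 1) * real (q ^ multiplicity q n) powr \<delta>)"
      by (intro prod_mono conjI local_bound of_nat_0_le_iff in_prime_factors_imp_prime)
    also have "\<dots> = (\<Prod>q\<in>?P. if q < B then K else 1) * (\<Prod>q\<in>?P. real (q ^ multiplicity q n) powr \<delta>)"
      by (rule prod.distrib)
    also have "(\<Prod>q\<in>?P. real (q ^ multiplicity q n) powr \<delta>) = real n powr \<delta>"
      by (simp only: prime_factorization_nat[OF n, symmetric] flip: prod_powr_distrib of_nat_prod)
    also have "(\<Prod>q\<in>?P. if q < B then K else 1) = K ^ card (?P \<inter> {..<B})"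
      by (simp add: prod.If_cases lessThan_def)
    also have "\<dots> \<le> K ^ B"
      using K card_mono[of "{..<B}" "?P \<inter> {..<B}"] by (intro power_increasing) auto
    finally show ?thesis by (simp add: mult_right_mono)
  qed
  moreover have "K ^ B \<ge> 1" using K by simp
  ultimately show ?thesis using that by blast
qed

text \<open>Replace \<open>gcd m n\<close> by the sum of all common divisors \<open>e\<close> of
  \<open>m\<close> and \<open>n\<close>, then exchange sums: each \<open>e\<close> has at most
  \<open>X div e\<close> multiples in the range, so it contributes at most \<open>X\<close>.\<close>

lemma sum_gcd_le:
  fixes n X :: nat
  assumes "n > 0"
  shows "(\<Sum>m\<in>{1..X}. gcd m n) \<le> X * divisor_count n"
proof -
  have fin: "finite {e. e dvd n}" using assms by simp
  have "(\<Sum>m\<in>{1..X}. gcd m n) \<le> (\<Sum>m\<in>{1..X}. \<Sum>e | e dvd n. if e dvd m then e else 0)"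
  proof (rule sum_mono)
    fix m
    have "(if gcd m n dvd m then gcd m n else 0) \<le> (\<Sum>e | e dvd n. if e dvd m then e else 0)"
      by (rule member_le_sum) (use fin in auto)
    then show "gcd m n \<le> (\<Sum>e | e dvd n. if e dvd m then e else 0)" by simp
  qed
  also have "\<dots> = (\<Sum>e | e dvd n. \<Sum>m\<in>{1..X}. if e dvd m then e else 0)" by (rule sum.swap)
  also have "\<dots> \<le> (\<Sum>e | e dvd n. X)"
  proof (rule sum_mono)
    fix e assume "e \<in> {e. e dvd n}"
    then have e: "e > 0" using assms by (auto intro: Nat.gr0I)
    have "{m \<in> {1..X}. e dvd m} \<subseteq> (\<lambda>k. e * k) ` {1..X div e}"
    proof
      fix m assume "m \<in> {m \<in> {1..X}. e dvd m}"
      then obtain k where k: "m = e * k" "1 \<le> m" "m \<le> X" by auto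
      then have "k \<le> X div e" using e by (simp add: less_eq_div_iff_mult_less_eq mult.commute)
      then show "m \<in> (\<lambda>k. e * k) ` {1..X div e}" using k by (intro image_eqI[of _ _ k]) (auto intro: Suc_leI Nat.gr0I)
    qed
    then have "card {m \<in> {1..X}. e dvd m} \<le> card {1..X div e}"
      by (intro surj_card_le) simp_all
    then have "card {m \<in> {1..X}. e dvd m} * e \<le> X"
      by (intro order_trans[OF mult_le_mono1 div_times_less_eq_dividend]) simp
    then show "(\<Sum>m\<in>{1..X}. if e dvd m then e else 0) \<le> X"
      by (simp add: sum.If_cases Int_def)
  qed
  also have "\<dots> = X * divisor_count n" by (simp add: divisor_count_def)
  finally show ?thesis .
qed

section \<open>Counting tools: one residue class in an interval, and Cauchy--Schwarz over
  fibres\<close>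

lemma card_residue_class_le:
  fixes Z :: "int set"
  assumes L: "L \<ge> 0" and Z: "Z \<subseteq> {-L..L}" and q: "q > 0" and cong: "\<And>x y. x \<in> Z \<Longrightarrow> y \<in> Z \<Longrightarrow> q dvd x - y"
  shows "int (card Z) \<le> 2 * L div q + 1"
proof (cases "Z = {}")
  case True
  then show ?thesis using L q by (simp add: pos_imp_zdiv_nonneg_iff)
next
  case False
  have fin: "finite Z" using Z finite_subset by blast
  let ?z = "Min Z"
  have z: "?z \<in> Z" "\<And>x. x \<in> Z \<Longrightarrow> ?z \<le> x" using False fin by auto
  have "Z \<subseteq> (\<lambda>k. ?z + q * k) ` {0..2 * L div q}"
  proof
    fix x assume x: "x \<in> Z"
    from cong[OF x z(1)] obtain k where k: "x - ?z = q * k" by blast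
    have "0 \<le> q * k" using z(2)[OF x] k by simp
    then have "0 \<le> k" using q by (simp add: zero_le_mult_iff)
    have "x \<in> {-L..L}" "?z \<in> {-L..L}" using x z(1) Z by blast+
    then have "k * q \<le> 2 * L" using k by (simp add: mult.commute)
    then have "k \<le> 2 * L div q" using q zdiv_mono1[of "k * q" "2 * L" q] by simp
    then show "x \<in> (\<lambda>k. ?z + q * k) ` {0..2 * L div q}" using \<open>0 \<le> k\<close> k by (auto intro!: image_eqI[of _ _ k])
  qed
  then have "card Z \<le> card {0..2 * L div q}" by (meson finite_atLeastAtMost_int surj_card_le)
  moreover have "0 \<le> 2 * L div q" using L q by (simp add: pos_imp_zdiv_nonneg_iff)
  ultimately show ?thesis by auto
qed

text \<open>Cauchy--Schwarz for the fibre sizes of \<open>f\<close>: they sum to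
  \<open>card W\<close>, and their squares sum to the number of colliding pairs.\<close>

lemma card_square_le_card_image_times_collisions:
  assumes "finite W"
  shows "(card W)\<^sup>2 \<le> card (f ` W) * card {(w, w'). w \<in> W \<and> w' \<in> W \<and> f w = f w'}"
proof -
  let ?F = "\<lambda>t. {w \<in> W. f w = t}"
  have "card W = (\<Sum>t\<in>f ` W. card (?F t))"
    using sum.group[OF assms finite_imageI[OF assms] subset_refl, where g = f and h = "\<lambda>_. 1::nat"] by simp
  then have "(real (card W))\<^sup>2 \<le> (\<Sum>t\<in>f ` W. (real (card (?F t)))\<^sup>2) * card (f ` W)"
    using sum_squared_le_sum_of_squares[of "\<lambda>t. real (card (?F t))" "f ` W"] by simp
  also have "(\<Sum>t\<in>f ` W. (real (card (?F t)))\<^sup>2) = real (\<Sum>t\<in>f ` W. card (?F t \<times> ?F t))"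
    by (simp add: card_cartesian_product power2_eq_square)
  also have "(\<Sum>t\<in>f ` W. card (?F t \<times> ?F t)) = card (\<Union>t\<in>f ` W. ?F t \<times> ?F t)"
    using assms by (subst card_UN_disjoint) auto
  also have "(\<Union>t\<in>f ` W. ?F t \<times> ?F t) = {(w, w'). w \<in> W \<and> w' \<in> W \<and> f w = f w'}" by auto
  finally have "real ((card W)\<^sup>2) \<le> real (card (f ` W) * card {(w, w'). w \<in> W \<and> w' \<in> W \<and> f w = f w'})"
    by (simp add: mult.commute)
  then show ?thesis using of_nat_le_iff by blast
qed

section \<open>Pairs with prescribed ratio and difference of inverses\<close>

text \<open>For units \<open>u\<close>, \<open>v\<close> the last condition says \<open>1/v - 1/u \<equiv> h\<close> modulo \<open>n\<close>.\<close>

definition shift_pairs :: "nat \<Rightarrow> nat \<Rightarrow> nat \<Rightarrow> nat \<Rightarrow> (int \<times> int) set" where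
  "shift_pairs p n c h = {(u, v). u \<in> {1..int n} \<and> v \<in> {1..int n} \<and>
     int p dvd v - int c * u \<and> int n dvd u - v - int h * u * v}"

lemma finite_shift_pairs: "finite (shift_pairs p n c h)"
  by (rule finite_subset[of _ "{1..int n} \<times> {1..int n}"]) (auto simp: shift_pairs_def)

lemma gcd_mult_le:
  fixes h k n :: nat
  assumes "n > 0"
  shows "gcd (h * k) n \<le> gcd h n * gcd k n"
proof -
  obtain d e where de: "gcd (h * k) n = d * e" "d dvd h" "e dvd k"
    using division_decomp[of "gcd (h * k) n" h k] by auto
  have "d * e dvd n" using de(1) by (metis gcd_dvd2)
  then have "d dvd gcd h n" "e dvd gcd k n"
    using de(2,3) by (auto dest: dvd_mult_left dvd_mult_right)
  then show ?thesis
    unfolding de(1) using assms by (intro dvd_imp_le mult_dvd_mono) auto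
qed

lemma eq_if_dvd_diff_bounded:
  fixes x y :: int
  assumes "int p dvd x - y" "x \<in> {1..int n}" "y \<in> {1..int n}" "n < p"
  shows "x = y"
  using assms dvd_imp_le_int[of "x - y" "int p"] by (cases "x = y") auto

text \<open>The ratio condition and \<open>n < p\<close> make \<open>v\<close> a function of
  \<open>u\<close>. This trivial bound serves for the translate by \<open>m = 0\<close>.\<close>

lemma card_shift_pairs_le: "n < p \<Longrightarrow> card (shift_pairs p n c h) \<le> n"
proof -
  assume np: "n < p"
  have "inj_on fst (shift_pairs p n c h)"
  proof (rule inj_onI, clarsimp simp: shift_pairs_def)
    fix u v v' :: int
    assume *: "int p dvd v - int c * u" "int p dvd v' - int c * u"
      "1 \<le> v" "v \<le> int n" "1 \<le> v'" "v' \<le> int n"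
    have "int p dvd (v - int c * u) - (v' - int c * u)" using *(1,2) by (rule dvd_diff)
    then show "v = v'" using * np by (intro eq_if_dvd_diff_bounded) auto
  qed
  then have "card (shift_pairs p n c h) \<le> card {1..int n}"
    by (rule card_inj_on_le) (auto simp: shift_pairs_def)
  then show ?thesis by simp
qed

section \<open>Pairs for a fixed representation of \<open>c\<close> as \<open>a/b\<close> modulo
  \<open>p\<close>\<close>

context
  fixes p n c h :: nat and a b A :: int
  assumes p: "prime p" "p > 2" and n: "0 < n" "n < p"
    and ab: "int p dvd a - int c * b" "\<not> int p dvd a" "\<bar>a\<bar> \<le> A" "\<bar>b\<bar> \<le> A"
begin

lemma A_pos: "A \<ge> 1"
  using ab by (cases "a = 0") auto

lemma linear_form_bound:
  assumes "\<bar>x\<bar> \<le> A" "\<bar>y\<bar> \<le> A" "u \<in> {1..int n}" "v \<in> {1..int n}"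
  shows "x * u + y * v \<in> {- (2 * A * int n)..2 * A * int n}"
proof -
  have "\<bar>x * u\<bar> \<le> A * int n" "\<bar>y * v\<bar> \<le> A * int n"
    unfolding abs_mult using assms A_pos by (auto intro!: mult_mono)
  then show ?thesis by auto
qed

text \<open>The form is congruent to \<open>2 a u\<close> modulo \<open>p\<close>.\<close>

lemma inj_on_linear_form: "inj_on (\<lambda>(u, v). a * u + b * v) (shift_pairs p n c h)"
proof (rule inj_onI, clarify)
  fix u v u' v'
  assume w: "(u, v) \<in> shift_pairs p n c h" "(u', v') \<in> shift_pairs p n c h"
    and eq: "a * u + b * v = a * u' + b * v'"
  have d: "int p dvd v - int c * u" "int p dvd v' - int c * u'"
    using w by (auto simp: shift_pairs_def)
  have "2 * a * (u - u') = (a * u + b * v) - (a * u' + b * v')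
      + ((a - int c * b) * u - (a - int c * b) * u')
      - (b * (v - int c * u) - b * (v' - int c * u'))"
    by (simp add: algebra_simps)
  also have "int p dvd \<dots>"
    unfolding eq using d ab(1) by simp
  finally have "int p dvd 2 * a * (u - u')" .
  moreover have "prime (int p)" using p by simp
  moreover have "\<not> int p dvd 2" using p zdvd_imp_le[of "int p" 2] by auto
  ultimately have "int p dvd u - u'" using ab(2) by (auto simp: prime_dvd_mult_iff)
  then have u: "u = u'" using w n by (intro eq_if_dvd_diff_bounded) (auto simp: shift_pairs_def)
  have "int p dvd (v - int c * u) - (v' - int c * u')" using d by (rule dvd_diff)
  then have "int p dvd v - v'" using u by simp
  then have "v = v'" using w n by (intro eq_if_dvd_diff_bounded) (auto simp: shift_pairs_def)
  with u show "u = u' \<and> v = v'" by simp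
qed

text \<open>With \<open>g = gcd (h m) n\<close>, the congruence modulo \<open>n\<close> fixes
  \<open>a u + b v\<close> modulo \<open>n / g\<close>. An interval of length \<open>4 A n\<close>
  contains at most \<open>4 A g + 1 \<le> 5 A g\<close> such values, and the form is injective on
  the pairs.\<close>

lemma card_translates_le:
  assumes m: "m \<noteq> 0"
  shows "int (card {(u, v). (u, v) \<in> shift_pairs p n c h \<and> (u + b * m, v + a * m) \<in> shift_pairs p n c h})
    \<le> 5 * A * gcd (int h * m) (int n)"
    (is "int (card ?D) \<le> _")
proof -
  let ?\<phi> = "\<lambda>(u, v). a * u + b * v"
  define g where "g = gcd (int h * m) (int n)"
  define q where "q = int n div g"
  have g: "g > 0" using n by (simp add: g_def)
  have nq: "int n = g * q" by (simp add: q_def g_def)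
  have q: "q > 0" using nq n g by (metis of_nat_0_less_iff zero_less_mult_pos)
  have D: "?D \<subseteq> shift_pairs p n c h" by auto
  have "card ?D = card (?\<phi> ` ?D)"
    using inj_on_subset[OF inj_on_linear_form D] by (simp add: card_image)
  also have "int \<dots> \<le> 2 * (2 * A * int n) div q + 1"
  proof (rule card_residue_class_le)
    show "0 \<le> 2 * A * int n" using A_pos by simp
    show "?\<phi> ` ?D \<subseteq> {- (2 * A * int n)..2 * A * int n}"
      using linear_form_bound ab(3,4) by (force simp: shift_pairs_def)
    show "q > 0" by (fact q)
    \<comment> \<open>Subtracting the quadratic congruences for \<open>(u, v)\<close> and its translate leaves a linear one.\<close>
    define \<kappa> where "\<kappa> = (b - a) * m - int h * a * b * m * m"
    have lin: "int n dvd int h * m * ?\<phi> w - \<kappa>" if "w \<in> ?D" for w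
    proof -
      obtain u v where w: "w = (u, v)" by (cases w)
      have "int n dvd (u - v - int h * u * v)
          - ((u + b * m) - (v + a * m) - int h * (u + b * m) * (v + a * m))"
        using that w by (intro dvd_diff[of _ "u - v - int h * u * v"]) (auto simp: shift_pairs_def)
      also have "\<dots> = int h * m * ?\<phi> w - \<kappa>" by (simp add: w \<kappa>_def algebra_simps)
      finally show ?thesis .
    qed
    fix x y assume "x \<in> ?\<phi> ` ?D" "y \<in> ?\<phi> ` ?D"
    then obtain w w' where w: "w \<in> ?D" "w' \<in> ?D" "x = ?\<phi> w" "y = ?\<phi> w'" by blast
    have "int n dvd (int h * m * x - \<kappa>) - (int h * m * y - \<kappa>)"
      using lin[OF w(1)] lin[OF w(2)] w(3,4) by (metis dvd_diff)
    then have "int n dvd (int h * m) * (x - y)" by (simp add: algebra_simps)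
    then have "g * q dvd g * ((int h * m) div g * (x - y))"
      using nq by (metis dvd_mult_div_cancel g_def gcd_dvd1 mult.assoc)
    then have "q dvd (int h * m) div g * (x - y)" using g by simp
    moreover have "coprime q ((int h * m) div g)"
      unfolding q_def g_def using n by (subst coprime_commute, intro div_gcd_coprime) auto
    ultimately show "q dvd x - y" by (simp add: coprime_dvd_mult_right_iff)
  qed
  also have "2 * (2 * A * int n) div q = 4 * A * g" using q by (simp add: nq)
  also have "4 * A * g + 1 \<le> 5 * A * g"
  proof -
    have "1 \<le> A * g" using A_pos g by (smt (verit) mult_le_cancel_right1)
    then show ?thesis by linarith
  qed
  finally show ?thesis by (simp add: g_def)
qed

text \<open>Since \<open>a\<close> and \<open>b\<close> are coprime, two pairs with equal
  \<open>b v - a u\<close> differ by \<open>m (b, a)\<close>. So the collisions are counted by the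
  translates, summed over the admissible \<open>m\<close>.\<close>

lemma card_collisions_le:
  assumes cop: "coprime a b" and b0: "b \<noteq> 0" and A: "A = max \<bar>a\<bar> \<bar>b\<bar>"
  shows "int (card {(w, w'). w \<in> shift_pairs p n c h \<and> w' \<in> shift_pairs p n c h \<and>
      (\<lambda>(u, v). b * v - a * u) w = (\<lambda>(u, v). b * v - a * u) w'})
    \<le> 11 * int n * int (gcd h n * divisor_count n)"
    (is "int (card ?P) \<le> _")
proof -
  let ?W = "shift_pairs p n c h"
  define D where "D m = {(u, v). (u, v) \<in> ?W \<and> (u + b * m, v + a * m) \<in> ?W}" for m
  \<comment> \<open>Both coordinates move by at most \<open>n\<close> and \<open>A\<close> is the
    larger of \<open>\<bar>a\<bar>\<close>, \<open>\<bar>b\<bar>\<close>, so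
    \<open>A * \<bar>m\<bar> \<le> n\<close>.\<close>
  define X where "X = n div nat A"
  have finD: "finite (D m)" for m
    by (rule finite_subset[OF _ finite_shift_pairs]) (auto simp: D_def)
  let ?pair = "\<lambda>m (u, v). ((u, v), (u + b * m, v + a * m))"
  have "?P \<subseteq> (\<Union>m\<in>{- int X..int X}. ?pair m ` D m)"
  proof clarify
    fix u v u' v'
    assume w: "(u, v) \<in> ?W" "(u', v') \<in> ?W" and "b * v - a * u = b * v' - a * u'"
    then have eq: "b * (v' - v) = a * (u' - u)" by (simp add: algebra_simps)
    have "b dvd a * (u' - u)" by (metis dvd_triv_left eq)
    then have "b dvd u' - u" using cop by (simp add: coprime_commute coprime_dvd_mult_right_iff)
    then obtain m where m: "u' - u = b * m" by blast
    with eq b0 have m': "v' - v = a * m"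
      by (metis mult.left_commute mult_left_cancel)
    have "\<bar>b * m\<bar> \<le> int n" "\<bar>a * m\<bar> \<le> int n"
      unfolding m[symmetric] m'[symmetric] using w by (auto simp: shift_pairs_def)
    then have "A * \<bar>m\<bar> \<le> int n" unfolding A abs_mult by (auto simp: max_def)
    then have "nat A * nat \<bar>m\<bar> \<le> n" using A_pos
      by (metis nat_int nat_mult_distrib nat_mono order_trans zero_le_one)
    then have "nat \<bar>m\<bar> \<le> X"
      unfolding X_def using A_pos by (simp add: less_eq_div_iff_mult_less_eq mult.commute)
    then have mX: "m \<in> {- int X..int X}" by auto
    have "u' = u + b * m" "v' = v + a * m" using m m' by auto
    then have "(u, v) \<in> D m" "((u, v), u', v') = ?pair m (u, v)" using w by (auto simp: D_def)
    then show "((u, v), u', v') \<in> (\<Union>m\<in>{- int X..int X}. ?pair m ` D m)" using mX by blast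
  qed
  then have "card ?P \<le> card (\<Union>m\<in>{- int X..int X}. ?pair m ` D m)"
    using finD by (intro card_mono) auto
  also have "\<dots> \<le> (\<Sum>m\<in>{- int X..int X}. card (?pair m ` D m))" by (rule card_UN_le) simp
  also have "\<dots> \<le> (\<Sum>m\<in>{- int X..int X}. card (D m))" by (intro sum_mono card_image_le finD)
  \<comment> \<open>The term \<open>m = 0\<close> gets the trivial bound \<open>n\<close>; splitting
    the rest by sign leaves two gcd sums over \<open>{1..X}\<close>.\<close>
  also have "{- int X..int X} = {0} \<union> (int ` {1..X} \<union> (\<lambda>k. - int k) ` {1..X})"
  proof
    show "{- int X..int X} \<subseteq> {0} \<union> (int ` {1..X} \<union> (\<lambda>k. - int k) ` {1..X})"
    proof
      fix m assume "m \<in> {- int X..int X}"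
      then have "m = 0 \<or> m = int (nat m) \<and> nat m \<in> {1..X} \<or> m = - int (nat (- m)) \<and> nat (- m) \<in> {1..X}"
        by auto
      then show "m \<in> {0} \<union> (int ` {1..X} \<union> (\<lambda>k. - int k) ` {1..X})" by blast
    qed
  qed auto
  also have "(\<Sum>m\<in>{0} \<union> (int ` {1..X} \<union> (\<lambda>k. - int k) ` {1..X}). card (D m))
      = card (D 0) + ((\<Sum>k=1..X. card (D (int k))) + (\<Sum>k=1..X. card (D (- int k))))"
    by (subst sum.union_disjoint, simp, simp, force, subst sum.union_disjoint, simp, simp, force)
       (simp add: sum.reindex inj_on_def)
  finally have "int (card ?P) \<le> int (card (D 0))
      + ((\<Sum>k=1..X. int (card (D (int k)))) + (\<Sum>k=1..X. int (card (D (- int k)))))"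
    unfolding of_nat_sum[symmetric] by linarith
  also have "\<dots> \<le> int n + ((\<Sum>k=1..X. 5 * A * int (gcd h n * gcd k n)) + (\<Sum>k=1..X. 5 * A * int (gcd h n * gcd k n)))"
  proof (intro add_mono sum_mono)
    show "int (card (D 0)) \<le> int n"
      using card_shift_pairs_le[OF n(2)] by (simp add: D_def)
    fix k assume k: "k \<in> {1..X}"
    have "int (gcd (h * k) n) \<le> int (gcd h n * gcd k n)"
      using gcd_mult_le[OF n(1)] by (rule of_nat_mono)
    then have "5 * A * int (gcd (h * k) n) \<le> 5 * A * int (gcd h n * gcd k n)"
      using A_pos by (intro mult_left_mono) simp_all
    then have le: "5 * A * gcd (int h * int k) (int n) \<le> 5 * A * int (gcd h n * gcd k n)"
      by (simp flip: of_nat_mult)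
    show "int (card (D (int k))) \<le> 5 * A * int (gcd h n * gcd k n)"
      using card_translates_le[of "int k"] k le unfolding D_def by simp
    show "int (card (D (- int k))) \<le> 5 * A * int (gcd h n * gcd k n)"
      using card_translates_le[of "- int k"] k le unfolding D_def by simp
  qed
  also have "\<dots> = int n + 10 * A * int (gcd h n) * int (\<Sum>k=1..X. gcd k n)"
    by (simp add: sum_distrib_left mult.assoc)
  also have "\<dots> \<le> int n + 10 * A * int (gcd h n) * int (X * divisor_count n)"
    using of_nat_mono[OF sum_gcd_le[OF n(1), of X]] A_pos by (intro add_left_mono mult_left_mono) simp_all
  also have "\<dots> = int n + 10 * (A * int X) * int (gcd h n * divisor_count n)" by simp
  \<comment> \<open>The constant 11 is 1 + 10: the term \<open>m = 0\<close> is absorbed because the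
    gcd and the divisor count are at least 1, and \<open>A X \<le> n\<close> handles the
    others.\<close>
  also have "\<dots> \<le> int n * int (gcd h n * divisor_count n) + 10 * int n * int (gcd h n * divisor_count n)"
  proof (intro add_mono mult_right_mono mult_left_mono)
    have "1 * 1 \<le> gcd h n * divisor_count n"
      using n divisor_count_pos[OF n(1)] by (intro mult_le_mono) (auto simp: Suc_le_eq)
    then show "int n \<le> int n * int (gcd h n * divisor_count n)"
      by (metis mult_1 mult.right_neutral mult_left_mono of_nat_0_le_iff of_nat_1 of_nat_le_iff)
    have "nat A * X \<le> n" unfolding X_def by simp
    then show "A * int X \<le> int n" using A_pos by (metis int_nat_eq of_nat_le_iff of_nat_mult order_trans zero_le_one)
  qed auto
  finally show ?thesis by (simp add: algebra_simps)
qed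

text \<open>Cauchy--Schwarz for \<open>b v - a u\<close>: its values are multiples of
  \<open>p\<close> of size at most \<open>2 A n\<close>, and \<open>n < p\<close>, so there are at
  most \<open>4 A + 1 \<le> 5 A\<close> of them. Then 55 = 5 * 11.\<close>

lemma card_shift_pairs_sq_le_max:
  assumes cop: "coprime a b" and b0: "b \<noteq> 0" and A: "A = max \<bar>a\<bar> \<bar>b\<bar>"
  shows "int ((card (shift_pairs p n c h))\<^sup>2) \<le> 55 * A * int n * int (gcd h n * divisor_count n)"
proof -
  let ?W = "shift_pairs p n c h"
  let ?k = "\<lambda>(u, v). b * v - a * u"
  have "int (card (?k ` ?W)) \<le> 2 * (2 * A * int n) div int p + 1"
  proof (rule card_residue_class_le)
    show "0 \<le> 2 * A * int n" using A_pos by simp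
    show "?k ` ?W \<subseteq> {- (2 * A * int n)..2 * A * int n}"
      using linear_form_bound[of "- a" b] ab(3,4) by (force simp: shift_pairs_def)
    show "int p > 0" using p by simp
    have "int p dvd ?k w" if "w \<in> ?W" for w
    proof -
      obtain u v where w: "w = (u, v)" by (cases w)
      have "?k w = b * (v - int c * u) - (a - int c * b) * u" by (simp add: w algebra_simps)
      also have "int p dvd \<dots>" using that ab(1) w by (auto simp: shift_pairs_def)
      finally show ?thesis .
    qed
    then show "int p dvd x - y" if "x \<in> ?k ` ?W" "y \<in> ?k ` ?W" for x y
      using that dvd_diff by blast
  qed
  also have "2 * (2 * A * int n) div int p \<le> 4 * A"
  proof -
    have "4 * A * int n \<le> 4 * A * int p" using n A_pos by (intro mult_left_mono) auto
    then show ?thesis using p zdiv_mono1[of "4 * A * int n" "4 * A * int p" "int p"] by (simp add: mult.assoc)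
  qed
  finally have k: "int (card (?k ` ?W)) \<le> 5 * A" using A_pos by linarith
  have "int ((card ?W)\<^sup>2) \<le> int (card (?k ` ?W)) *
      int (card {(w, w'). w \<in> ?W \<and> w' \<in> ?W \<and> ?k w = ?k w'})"
    using card_square_le_card_image_times_collisions[OF finite_shift_pairs, of p n c h ?k]
    by (simp only: of_nat_le_iff flip: of_nat_mult)
  also have "\<dots> \<le> (5 * A) * (11 * int n * int (gcd h n * divisor_count n))"
    using k card_collisions_le[OF assms] A_pos by (intro mult_mono) auto
  finally show ?thesis by simp
qed

end

text \<open>Dirichlet approximation of \<open>c / p\<close> with denominator at most
  \<open>sqrt p\<close> supplies the small fraction \<open>a/b\<close>, with
  \<open>A \<le> 2 sqrt p\<close>; this turns 55 into 110.\<close>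

lemma card_shift_pairs_sq_le:
  fixes p n c h :: nat
  assumes p: "prime p" "p > 2" and n: "0 < n" "n < p" and c: "\<not> p dvd c"
  shows "(real (card (shift_pairs p n c h)))\<^sup>2
    \<le> 110 * sqrt p * real n * real (gcd h n) * real (divisor_count n)"
proof -
  define N where "N = nat \<lfloor>sqrt p\<rfloor>"
  have sp: "sqrt p \<ge> 1" using p by simp
  then have N0: "N > 0" unfolding N_def by linarith
  have N1: "real N \<le> sqrt p" "sqrt p < real N + 1" using sp unfolding N_def by linarith+
  obtain r b where rb: "coprime r b" "0 < b" "b \<le> int N" "\<bar>of_int b * (real c / real p) - of_int r\<bar> < 1 / N"
    using Dirichlet_approx_coprime[OF N0] by metis
  \<comment> \<open>Up to sign, \<open>a\<close> is \<open>p\<close> times the approximation error,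
    so \<open>\<bar>a\<bar> < p / N\<close>; and \<open>sqrt p < N + 1 \<le> 2 N\<close>.\<close>
  define a where "a = int c * b - r * int p"
  have p0: "real p > 0" using p by simp
  have "\<bar>real_of_int a\<bar> = \<bar>of_int b * (real c / real p) - of_int r\<bar> * real p"
    using p0 by (simp add: a_def abs_mult_pos' field_simps)
  also have "\<dots> < 1 / N * real p" using rb(4) p0 by (rule mult_strict_right_mono)
  also have "\<dots> \<le> 2 * sqrt p"
  proof -
    have "real p = sqrt p * sqrt p" by simp
    also have "\<dots> \<le> sqrt p * (2 * real N)"
    proof (rule mult_left_mono)
      have "real N \<ge> 1" using N0 by simp
      then show "sqrt p \<le> 2 * real N" using N1 by linarith
    qed simp
    finally show ?thesis using N0 by (simp add: field_simps)
  qed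
  finally have a_le: "\<bar>real_of_int a\<bar> \<le> 2 * sqrt p" by simp
  have b_le: "\<bar>real_of_int b\<bar> \<le> 2 * sqrt p" using rb(2,3) N1 sp by linarith
  have "sqrt p * 1 < sqrt p * sqrt p" using p by (intro mult_strict_left_mono) auto
  then have "sqrt p < real p" by simp
  then have "real_of_int b < real p" using rb(3) N1 by linarith
  then have bp: "b < int p" by linarith
  then have b_not_dvd: "\<not> int p dvd b" using rb(2) zdvd_not_zless by blast
  have prime: "prime (int p)" using p by simp
  have "int p dvd a - int c * b" by (simp add: a_def)
  moreover have "\<not> int p dvd a"
  proof
    assume "int p dvd a"
    then have "int p dvd a + r * int p" by simp
    then have "int p dvd int c * b" by (simp add: a_def)
    then show False using c b_not_dvd prime by (simp add: prime_dvd_mult_iff)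
  qed
  \<comment> \<open>Modulo \<open>b\<close>, \<open>a\<close> is \<open>- r p\<close>; both
    \<open>r\<close> and \<open>p\<close> are coprime to \<open>b\<close>.\<close>
  moreover have "coprime a b"
  proof -
    have "coprime (int p) b" using prime b_not_dvd by (simp add: prime_imp_coprime)
    then have "coprime (r * int p) b" using rb(1) by simp
    then show ?thesis
      unfolding a_def coprime_iff_gcd_eq_1 by (metis gcd_diff1 gcd.commute gcd_add_mult mult.commute diff_conv_add_uminus gcd_neg1 minus_mult_left)
  qed
  ultimately have "int ((card (shift_pairs p n c h))\<^sup>2)
      \<le> 55 * max \<bar>a\<bar> \<bar>b\<bar> * int n * int (gcd h n * divisor_count n)"
    using p n rb(2) by (intro card_shift_pairs_sq_le_max) auto
  then have "real_of_int (int ((card (shift_pairs p n c h))\<^sup>2))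
      \<le> real_of_int (55 * max \<bar>a\<bar> \<bar>b\<bar> * int n * int (gcd h n * divisor_count n))"
    by (simp only: of_int_le_iff)
  then have "(real (card (shift_pairs p n c h)))\<^sup>2
      \<le> 55 * real_of_int (max \<bar>a\<bar> \<bar>b\<bar>) * (real n * (real (gcd h n) * real (divisor_count n)))"
    by (simp add: mult.assoc)
  also have "\<dots> \<le> 55 * (2 * sqrt p) * (real n * (real (gcd h n) * real (divisor_count n)))"
    using a_le b_le by (intro mult_right_mono mult_left_mono) auto
  finally show ?thesis by (simp add: mult.assoc)
qed

section \<open>Solutions of the exponential congruence\<close>

lemma cong_power_exponents:
  fixes x p :: nat
  assumes "prime p" "coprime x p" "[i = j] (mod (p - 1))"
  shows "[x ^ i = x ^ j] (mod p)"
proof -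
  have "ord p x dvd p - 1"
    using order_divides_totient[of p x] assms by (simp add: coprime_commute totient_prime)
  then have "[i = j] (mod ord p x)" using assms(3) cong_dvd_modulus_nat by blast
  then show ?thesis using assms(2) by (simp add: order_divides_expdiff coprime_commute)
qed

text \<open>When \<open>p - 1 = d n\<close>, coprimality of \<open>u\<close> and \<open>n\<close>
  says that \<open>gcd (d u) (p - 1) = d\<close>; so \<open>d\<close> sorts the solutions by this
  gcd.\<close>

definition multiples_with_value :: "nat \<Rightarrow> nat \<Rightarrow> nat \<Rightarrow> nat \<Rightarrow> nat set" where
  "multiples_with_value p d n l =
     {u. u \<in> {1..n} \<and> coprime u n \<and> [(d * u) ^ (d * u) = l] (mod p)}"

lemma finite_multiples_with_value: "finite (multiples_with_value p d n l)"
  by (rule finite_subset[of _ "{1..n}"]) (auto simp: multiples_with_value_def)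

context
  fixes p d n l :: nat
  assumes p: "prime p" and dn: "p - 1 = d * n"
begin

lemma d_n_pos: "d > 0" "n > 0" "n < p"
proof -
  have "d * n > 0" using dn prime_gt_1_nat[OF p] by linarith
  then show "d > 0" "n > 0" by auto
  then have "n \<le> d * n" by simp
  then show "n < p" using dn prime_gt_1_nat[OF p] by linarith
qed

lemma coprime_multiple:
  assumes "u \<in> {1..n}"
  shows "coprime (d * u) p"
proof -
  have "0 < d * u" "d * u \<le> d * n" using assms d_n_pos by auto
  moreover have "d * n < p" using dn prime_gt_1_nat[OF p] by linarith
  ultimately have "\<not> p dvd d * u" using dvd_imp_le[of p "d * u"] by linarith
  then show ?thesis using prime_imp_coprime[OF p] coprime_commute by blast
qed

text \<open>As \<open>u e \<equiv> 1\<close> modulo \<open>n\<close>, the exponent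
  \<open>d u e\<close> is congruent to \<open>d\<close> modulo \<open>d n = p - 1\<close>, and
  Fermat applies.\<close>

lemma value_power_inverse:
  assumes u: "u \<in> multiples_with_value p d n l" and e: "[u * e = 1] (mod n)"
  shows "[l ^ e = (d * u) ^ d] (mod p)"
proof -
  have u1: "u \<in> {1..n}" "[l = (d * u) ^ (d * u)] (mod p)"
    using u by (auto simp: multiples_with_value_def cong_sym)
  have "[l ^ e = ((d * u) ^ (d * u)) ^ e] (mod p)" using u1(2) by (rule cong_pow)
  also have "((d * u) ^ (d * u)) ^ e = (d * u) ^ (d * (u * e))"
    by (simp add: mult.assoc flip: power_mult)
  also have "[(d * u) ^ (d * (u * e)) = (d * u) ^ d] (mod p)"
  proof (rule cong_power_exponents[OF p coprime_multiple[OF u1(1)]])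
    have "d * ((u * e) mod n) = d * (1 mod n)" using e by (simp only: unique_euclidean_semiring_class.cong_def)
    then show "[d * (u * e) = d] (mod (p - 1))"
      by (simp only: dn unique_euclidean_semiring_class.cong_def mult_mod_right mult_1_right)
  qed
  finally show ?thesis .
qed

text \<open>Dividing the relations of \<open>value_power_inverse\<close> for \<open>v\<close> and
  \<open>u\<close> gives \<open>(v/u) ^ d \<equiv> l ^ h\<close> modulo \<open>p\<close>, where
  \<open>h\<close> is the difference of the inverses modulo \<open>n\<close>; so \<open>c\<close> is
  the residue of \<open>v/u\<close>.\<close>

lemma pair_in_shift_pairs:
  assumes u: "u \<in> multiples_with_value p d n l" and v: "v \<in> multiples_with_value p d n l"
  obtains h c where "h \<in> {1..n}" "c < p" "\<not> p dvd c" "[c ^ d = l ^ h] (mod p)"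
    "(int u, int v) \<in> shift_pairs p n c h"
proof -
  have uv: "u \<in> {1..n}" "v \<in> {1..n}" "coprime u n" "coprime v n"
    using u v by (auto simp: multiples_with_value_def)
  obtain u' where u': "[u * u' = 1] (mod n)" using cong_solve_coprime_nat[OF uv(3)] by auto
  obtain v' where v': "[v * v' = 1] (mod n)" using cong_solve_coprime_nat[OF uv(4)] by auto
  \<comment> \<open>Subtracting and adding 1 selects the representative of \<open>v' - u'\<close> in
    \<open>{1..n}\<close>, the range of the gcd sum.\<close>
  define h where "h = nat ((int v' - int u' - 1) mod int n) + 1"
  have h: "h \<in> {1..n}"
    using d_n_pos pos_mod_bound[of "int n" "int v' - int u' - 1"] pos_mod_sign[of "int n" "int v' - int u' - 1"]
    unfolding h_def by (auto simp: nat_less_iff Suc_le_eq)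
  have "int h = (int v' - int u' - 1) mod int n + 1" using d_n_pos by (simp add: h_def)
  then have "[int h = (int v' - int u' - 1) + 1] (mod int n)"
    by (simp only: cong_add_rcancel) (simp add: unique_euclidean_semiring_class.cong_def)
  then have "[int h + int u' = (int v' - int u' - 1) + 1 + int u'] (mod int n)"
    by (simp only: cong_add_rcancel)
  then have "[int (h + u') = int v'] (mod int n)" by simp
  then have "[h + u' = v'] (mod n)" by (simp only: cong_int_iff)
  then have "[v * (h + u') = v * v'] (mod n)" by (rule cong_scalar_left)
  \<comment> \<open>Hence \<open>h + u'\<close> can serve as the inverse of \<open>v\<close>, so
    that \<open>l ^ (h + u')\<close> splits exactly.\<close>
  then have e: "[v * (h + u') = 1] (mod n)" using v' cong_trans by blast

  have cop_u: "coprime u p" using coprime_multiple[OF uv(1)] by simp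
  obtain w where w: "[u * w = 1] (mod p)" using cong_solve_coprime_nat[OF cop_u] by auto
  define c where "c = (w * v) mod p"
  have p0: "p > 0" using prime_gt_0_nat[OF p] .
  have "[c * u = w * v * u] (mod p)" unfolding c_def unique_euclidean_semiring_class.cong_def by (rule mod_mult_left_eq)
  also have "w * v * u = (u * w) * v" by simp
  also have "[(u * w) * v = 1 * v] (mod p)" using w by (rule cong_scalar_right)
  finally have cu: "[c * u = v] (mod p)" by simp
  have "\<not> p dvd v" using uv(2) d_n_pos by (auto dest: dvd_imp_le)
  then have c: "\<not> p dvd c" using cu cong_dvd_iff dvd_mult2 by blast

  have "[c ^ d * (d * u) ^ d = (d * (c * u)) ^ d] (mod p)"
    by (simp add: power_mult_distrib mult_ac)
  also have "[(d * (c * u)) ^ d = (d * v) ^ d] (mod p)"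
    using cu by (intro cong_pow cong_scalar_left)
  also have "[(d * v) ^ d = l ^ (h + u')] (mod p)"
    using value_power_inverse[OF v e] by (rule cong_sym)
  also have "l ^ (h + u') = l ^ h * l ^ u'" by (rule power_add)
  also have "[l ^ h * l ^ u' = l ^ h * (d * u) ^ d] (mod p)"
    using value_power_inverse[OF u u'] by (rule cong_scalar_left)
  finally have "[c ^ d = l ^ h] (mod p)"
    using coprime_multiple[OF uv(1)] by (subst (asm) cong_mult_rcancel_nat) auto

  moreover have "(int u, int v) \<in> shift_pairs p n c h"
  proof -
    have "[int (c * u) = int v] (mod int p)" using cu by (simp only: cong_int_iff)
    then have 1: "int p dvd int v - int c * int u"
      by (simp add: cong_iff_dvd_diff dvd_diff_commute)
    have "[u * (v * (h + u')) = u * 1] (mod n)" using e by (rule cong_scalar_left)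
    moreover have "u * (v * (h + u')) = h * u * v + v * (u * u')" by (simp add: algebra_simps)
    moreover have "[h * u * v + v * (u * u') = h * u * v + v * 1] (mod n)"
      using u' by (intro cong_add cong_refl cong_scalar_left)
    ultimately have "[u = h * u * v + v] (mod n)"
      by (metis cong_sym cong_trans mult.right_neutral)
    then have "[int u = int (h * u * v + v)] (mod int n)" by (simp only: cong_int_iff)
    then have "int n dvd int u - int v - int h * int u * int v"
      by (simp add: cong_iff_dvd_diff algebra_simps)
    with 1 uv show ?thesis by (auto simp: shift_pairs_def)
  qed
  moreover have "c < p" using p0 by (simp add: c_def)
  ultimately show ?thesis using that[OF h _ c] by blast
qed

text \<open>All pairs \<open>(u, v)\<close> are covered by the classes \<open>T h c\<close>. At most
  \<open>d\<close> roots \<open>c\<close> for each \<open>h\<close>, with gcds averaging at most the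
  divisor count over \<open>h\<close>, give the factor \<open>d n < p\<close>.\<close>

lemma card_multiples_sq_le:
  assumes p2: "p > 2"
  shows "(real (card (multiples_with_value p d n l)))\<^sup>2
    \<le> 11 * real p powr (7 / 4) * (real (divisor_count n))\<^sup>2"
proof -
  let ?U = "multiples_with_value p d n l"
  let ?\<tau> = "real (divisor_count n)"
  define C where "C h = {c. c < p \<and> \<not> p dvd c \<and> [c ^ d = l ^ h] (mod p)}" for h
  define T where "T h c = {(u, v). u \<in> ?U \<and> v \<in> ?U \<and> (int u, int v) \<in> shift_pairs p n c h}" for h c
  have \<tau>: "?\<tau> \<ge> 1" using divisor_count_pos[OF d_n_pos(2)] by simp
  have finT: "finite (T h c)" for h c
    by (rule finite_subset[of _ "?U \<times> ?U"]) (auto simp: T_def finite_multiples_with_value)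
  have finC: "finite (C h)" for h by (simp add: C_def)
  have cardC: "card (C h) \<le> d" for h
  proof -
    have "card (C h) \<le> card {x \<in> {..<p}. [x ^ d = l ^ h] (mod p)}"
      by (rule card_mono) (auto simp: C_def)
    also have "\<dots> \<le> d" using roots_mod_prime_bound[OF p d_n_pos(1)] .
    finally show ?thesis .
  qed
  define R where "R = sqrt (110 * sqrt p * real n * ?\<tau>)"
  have R0: "R \<ge> 0" by (simp add: R_def)
  have cardT: "real (card (T h c)) \<le> R * real (gcd h n)" if "c \<in> C h" for h c
  proof -
    have g: "real (gcd h n) \<ge> 1" using d_n_pos by (simp add: Suc_le_eq)
    have "card (T h c) \<le> card (shift_pairs p n c h)"
      by (rule card_inj_on_le[of "\<lambda>(u, v). (int u, int v)"])
         (auto simp: T_def inj_on_def finite_shift_pairs)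
    then have "(real (card (T h c)))\<^sup>2 \<le> (real (card (shift_pairs p n c h)))\<^sup>2" by simp
    also have "\<dots> \<le> 110 * sqrt p * real n * real (gcd h n) * ?\<tau>"
      using that by (intro card_shift_pairs_sq_le p p2 d_n_pos) (auto simp: C_def)
    also have "\<dots> = (110 * sqrt p * real n * ?\<tau>) * real (gcd h n)" by simp
    \<comment> \<open>Squaring the gcd keeps the root free of \<open>sqrt (gcd h n)\<close>, so that
      \<open>sum_gcd_le\<close> applies.\<close>
    also have "\<dots> \<le> (110 * sqrt p * real n * ?\<tau>) * (real (gcd h n))\<^sup>2"
      using g by (intro mult_left_mono self_le_power) auto
    also have "\<dots> = (R * real (gcd h n))\<^sup>2" by (simp add: R_def power_mult_distrib)
    finally show ?thesis using R0 by (simp add: power2_le_iff_abs_le)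
  qed
  have "?U \<times> ?U \<subseteq> (\<Union>h\<in>{1..n}. \<Union>c\<in>C h. T h c)"
  proof clarify
    fix u v assume uv: "u \<in> ?U" "v \<in> ?U"
    show "(u, v) \<in> (\<Union>h\<in>{1..n}. \<Union>c\<in>C h. T h c)"
      by (rule pair_in_shift_pairs[OF uv]) (use uv in \<open>unfold C_def T_def, blast\<close>)
  qed
  then have "card (?U \<times> ?U) \<le> card (\<Union>h\<in>{1..n}. \<Union>c\<in>C h. T h c)"
    using finT finC by (intro card_mono) auto
  also have "\<dots> \<le> (\<Sum>h=1..n. card (\<Union>c\<in>C h. T h c))" by (rule card_UN_le) simp
  also have "\<dots> \<le> (\<Sum>h=1..n. \<Sum>c\<in>C h. card (T h c))" by (intro sum_mono card_UN_le finC)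
  finally have "real (card (?U \<times> ?U)) \<le> (\<Sum>h=1..n. \<Sum>c\<in>C h. real (card (T h c)))"
    unfolding of_nat_sum[symmetric] of_nat_le_iff .
  also have "\<dots> \<le> (\<Sum>h=1..n. \<Sum>c\<in>C h. R * real (gcd h n))"
    by (intro sum_mono cardT)
  also have "\<dots> \<le> (\<Sum>h=1..n. real d * (R * real (gcd h n)))"
    using cardC R0 by (auto intro!: sum_mono mult_right_mono)
  also have "\<dots> = real d * R * real (\<Sum>h=1..n. gcd h n)"
    by (simp add: sum_distrib_left mult.assoc)
  also have "\<dots> \<le> real d * R * real (n * divisor_count n)"
    using sum_gcd_le[OF d_n_pos(2), of n] R0 by (intro mult_left_mono of_nat_mono) auto
  also have "\<dots> = real (d * n) * R * ?\<tau>" by simp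
  also have "\<dots> \<le> real p * (11 * real p powr (3 / 4) * ?\<tau>) * ?\<tau>"
  proof (intro mult_right_mono mult_mono)
    show "real (d * n) \<le> real p" unfolding dn[symmetric] by simp
    \<comment> \<open>The bound is enlarged to a perfect square, with 121 = 11 * 11 and
      \<open>n < p\<close>.\<close>
    have "110 * sqrt p * real n * ?\<tau> \<le> 121 * sqrt p * real p * ?\<tau>\<^sup>2"
      using \<tau> d_n_pos(3) by (intro mult_mono self_le_power) auto
    also have "\<dots> = 121 * real p powr (1 / 2 + 1) * ?\<tau>\<^sup>2"
      by (simp only: powr_add powr_half_sqrt powr_one of_nat_0_le_iff mult.assoc)
    also have "real p powr (1 / 2 + 1) = (real p powr (3 / 4))\<^sup>2"
      using p2 by (simp add: power2_eq_square flip: powr_add)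
    also have "121 * (real p powr (3 / 4))\<^sup>2 * ?\<tau>\<^sup>2 = (11 * real p powr (3 / 4) * ?\<tau>)\<^sup>2"
      by (simp add: power_mult_distrib)
    finally show "R \<le> 11 * real p powr (3 / 4) * ?\<tau>"
      unfolding R_def by (intro real_le_lsqrt) auto
  qed (use R0 in auto)
  also have "\<dots> = 11 * (real p powr 1 * real p powr (3 / 4)) * ?\<tau>\<^sup>2"
    using p2 by (simp add: power2_eq_square)
  also have "real p powr 1 * real p powr (3 / 4) = real p powr (7 / 4)"
    by (simp flip: powr_add del: powr_one powr_one')
  finally show ?thesis by (simp add: card_cartesian_product power2_eq_square)
qed

end

text \<open>Makes the bound uniform in \<open>d\<close>, as \<open>n\<close> divides
  \<open>p - 1\<close>; 11 is rounded up to the square 16 before taking roots.\<close>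

lemma card_multiples_le:
  assumes "prime p" "p > 2" "p - 1 = d * n"
  shows "real (card (multiples_with_value p d n l))
    \<le> 4 * real p powr (7 / 8) * real (divisor_count (p - 1))"
proof -
  have mono: "divisor_count n \<le> divisor_count (p - 1)"
  proof (rule divisor_count_mono)
    show "n dvd p - 1" unfolding assms(3) by simp
    show "p - 1 > 0" using assms(2) by simp
  qed
  have "(real (card (multiples_with_value p d n l)))\<^sup>2
      \<le> 11 * real p powr (7 / 4) * (real (divisor_count n))\<^sup>2"
    by (rule card_multiples_sq_le[OF assms(1,3,2)])
  also have "\<dots> \<le> 16 * real p powr (7 / 4) * (real (divisor_count (p - 1)))\<^sup>2"
    using mono by (intro mult_mono power_mono) auto
  also have "real p powr (7 / 4) = (real p powr (7 / 8))\<^sup>2"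
    using assms by (simp add: power2_eq_square flip: powr_add)
  also have "16 * (real p powr (7 / 8))\<^sup>2 * (real (divisor_count (p - 1)))\<^sup>2
      = (4 * real p powr (7 / 8) * real (divisor_count (p - 1)))\<^sup>2"
    by (simp add: power_mult_distrib)
  finally have "(real (card (multiples_with_value p d n l)))\<^sup>2
      \<le> (4 * real p powr (7 / 8) * real (divisor_count (p - 1)))\<^sup>2" .
  then show ?thesis by (rule power2_le_imp_le) simp
qed

text \<open>Sort \<open>y\<close> by \<open>d = gcd y (p - 1)\<close>; then \<open>y / d\<close> is
  coprime to \<open>(p - 1) / d\<close>. The number of choices of \<open>d\<close> supplies the
  second divisor-count factor.\<close>

lemma card_self_power_fibre_le:
  assumes "prime p" "p > 2"
  shows "real (card {y \<in> {1..p - 1}. [y ^ y = l] (mod p)})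
    \<le> 4 * real p powr (7 / 8) * (real (divisor_count (p - 1)))\<^sup>2"
proof -
  let ?N = "p - 1"
  have N0: "?N > 0" using assms by simp
  let ?V = "\<lambda>d. (\<lambda>u. d * u) ` multiples_with_value p d (?N div d) l"
  have fin: "finite {d. d dvd ?N}" using N0 by simp
  have "{y \<in> {1..?N}. [y ^ y = l] (mod p)} \<subseteq> (\<Union>d\<in>{d. d dvd ?N}. ?V d)"
  proof clarify
    fix y assume y: "y \<in> {1..?N}" "[y ^ y = l] (mod p)"
    define d where "d = gcd y ?N"
    have d0: "d > 0" using N0 by (simp add: d_def)
    have y_eq: "y = d * (y div d)" and "d dvd ?N" by (simp_all add: d_def)
    have "coprime (y div d) (?N div d)"
      unfolding d_def using N0 by (intro div_gcd_coprime) auto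
    moreover have "y div d \<in> {1..?N div d}"
      using y(1) y_eq d0 by (auto intro: div_le_mono simp: Suc_le_eq intro!: Nat.gr0I)
    ultimately have "y div d \<in> multiples_with_value p d (?N div d) l"
      using y(2) y_eq by (simp add: multiples_with_value_def)
    then have "y \<in> ?V d" using y_eq by blast
    then show "y \<in> (\<Union>d\<in>{d. d dvd ?N}. ?V d)" using \<open>d dvd ?N\<close> by blast
  qed
  then have "card {y \<in> {1..?N}. [y ^ y = l] (mod p)} \<le> card (\<Union>d\<in>{d. d dvd ?N}. ?V d)"
    using fin by (intro card_mono) (auto simp: finite_multiples_with_value)
  also have "\<dots> \<le> (\<Sum>d | d dvd ?N. card (?V d))" by (rule card_UN_le[OF fin])
  also have "\<dots> \<le> (\<Sum>d | d dvd ?N. card (multiples_with_value p d (?N div d) l))"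
    by (intro sum_mono card_image_le finite_multiples_with_value)
  finally have "real (card {y \<in> {1..?N}. [y ^ y = l] (mod p)})
      \<le> (\<Sum>d | d dvd ?N. real (card (multiples_with_value p d (?N div d) l)))"
    unfolding of_nat_sum[symmetric] of_nat_le_iff .
  also have "\<dots> \<le> (\<Sum>d | d dvd ?N. 4 * real p powr (7 / 8) * real (divisor_count ?N))"
    using assms by (intro sum_mono card_multiples_le) auto
  also have "\<dots> = 4 * real p powr (7 / 8) * (real (divisor_count ?N))\<^sup>2"
    by (simp add: divisor_count_def power2_eq_square)
  finally show ?thesis .
qed

section \<open>Assembling the bound for \<open>I p\<close>\<close>

lemma I_le:
  assumes "prime p" "p > 2"
  shows "real (I p) \<le> 4 * real p powr (15 / 8) * (real (divisor_count (p - 1)))\<^sup>2"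
proof -
  let ?F = "\<lambda>x. {y \<in> {1..p - 1}. [y ^ y = x ^ x] (mod p)}"
  let ?B = "4 * real p powr (7 / 8) * (real (divisor_count (p - 1)))\<^sup>2"
  have "solutions p = Sigma {1..p - 1} ?F"
    unfolding solutions_def by (auto simp: cong_sym_eq)
  then have "real (I p) = (\<Sum>x=1..p - 1. real (card (?F x)))"
    by (simp add: I_def)
  also have "\<dots> \<le> (\<Sum>x=1..p - 1. ?B)"
    by (intro sum_mono card_self_power_fibre_le assms)
  also have "\<dots> \<le> real p * ?B"
    by (simp only: sum_constant card_atLeastAtMost) (intro mult_right_mono, auto)
  also have "real p * ?B = 4 * (real p powr 1 * real p powr (7 / 8)) * (real (divisor_count (p - 1)))\<^sup>2"
    by simp
  also have "real p powr 1 * real p powr (7 / 8) = real p powr (15 / 8)"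
    by (simp flip: powr_add del: powr_one powr_one')
  finally show ?thesis .
qed

theorem theorem3:
  shows "\<forall>\<epsilon>::real. \<epsilon> > 0 \<longrightarrow>
    (\<exists>c::real. c > 0 \<and> (\<forall>p::nat. prime p \<longrightarrow> real (I p) < c * real p powr (23 / 12 + \<epsilon>)))"
proof (intro allI impI)
  fix \<epsilon> :: real assume \<epsilon>: "\<epsilon> > 0"
  \<comment> \<open>The squared divisor count costs \<open>p powr (2 / 48)\<close>, and 15/8 + 1/24
    = 23/12.\<close>
  obtain C where C: "C \<ge> 1" "\<And>n. n > 0 \<Longrightarrow> real (divisor_count n) \<le> C * real n powr (1 / 48)"
    using divisor_count_bound[of "1 / 48"] by auto
  \<comment> \<open>The added 1 makes the final inequality strict.\<close>
  have "real (I p) < (4 * C\<^sup>2 + 1) * real p powr (23 / 12 + \<epsilon>)" if p: "prime p" for p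
  proof -
    have p2: "p \<ge> 2" using p by (rule prime_ge_2_nat)
    have "real (I p) \<le> 4 * C\<^sup>2 * real p powr (23 / 12)"
    proof (cases "p = 2")
      \<comment> \<open>\<open>I_le\<close> covers odd primes; for \<open>p = 2\<close> only the
        pair \<open>(1, 1)\<close> is in range.\<close>
      case True
      have "solutions 2 \<subseteq> {(1, 1)}" by (auto simp: solutions_def)
      then have "I 2 \<le> 1" unfolding I_def using card_mono[of "{(1::nat, 1::nat)}"] by simp
      moreover have "1 * 1 \<le> 4 * C\<^sup>2 * 2 powr (23 / 12)"
      proof (rule mult_mono)
        show "1 \<le> 4 * C\<^sup>2" using one_le_power[OF C(1), of 2] by linarith
      qed (simp_all add: ge_one_powr_ge_zero)
      ultimately show ?thesis using True by simp
    next
      case False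
      have "real (divisor_count (p - 1)) \<le> C * real (p - 1) powr (1 / 48)"
        using p2 by (intro C) auto
      also have "\<dots> \<le> C * real p powr (1 / 48)"
        using C(1) by (intro mult_left_mono powr_mono2) auto
      finally have "(real (divisor_count (p - 1)))\<^sup>2 \<le> (C * real p powr (1 / 48))\<^sup>2"
        by (intro power_mono) auto
      also have "\<dots> = C\<^sup>2 * real p powr (1 / 24)"
        by (simp add: power2_eq_square flip: powr_add)
      finally have "4 * real p powr (15 / 8) * (real (divisor_count (p - 1)))\<^sup>2
          \<le> 4 * real p powr (15 / 8) * (C\<^sup>2 * real p powr (1 / 24))"
        by (intro mult_left_mono) auto
      also have "\<dots> = 4 * C\<^sup>2 * (real p powr (15 / 8) * real p powr (1 / 24))" by simp
      also have "real p powr (15 / 8) * real p powr (1 / 24) = real p powr (23 / 12)"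
        by (simp flip: powr_add)
      finally show ?thesis using I_le[OF p] False p2 by linarith
    qed
    also have "\<dots> \<le> 4 * C\<^sup>2 * real p powr (23 / 12 + \<epsilon>)"
      using p2 \<epsilon> by (intro mult_left_mono powr_mono) auto
    also have "\<dots> < (4 * C\<^sup>2 + 1) * real p powr (23 / 12 + \<epsilon>)"
      using p2 by (simp add: algebra_simps)
    finally show ?thesis .
  qed
  moreover have "0 < 4 * C\<^sup>2 + 1" using zero_le_power2[of C] by linarith
  ultimately show "\<exists>c::real. c > 0 \<and> (\<forall>p::nat. prime p \<longrightarrow> real (I p) < c * real p powr (23 / 12 + \<epsilon>))"
    by blast
qed

end
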